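(* Let $X$ be a non-empty locally compact proper metric space on which a group $\Gamma$ acts as isometries. Let $D$ be a uniformly discrete subset of $X$ and set $\mu=\sum_{x\in D}\delta_x$, the sum of Dirac measures with respect to the vague topology. Regard $D$ as an abstract pattern of $\mathrm{UD}(X)$ and $\mu$ as an abstract pattern of $C_c(X)^{*}$. Then: (1) $\mu\wedge C=\sum_{x\in D\cap C}\delta_x$ for each closed $C\subset X$; (2) $\gamma\mu=\sum_{x\in\gamma D}\delta_x$ for each $\gamma\in\Gamma$; (3) $\mu$ and $D$ are mutually locally derivable.
   Context: $B(x,r)$ denotes the closed ball; proper means all closed balls are compact; $\mathrm{Cl}(X)$ is the set of closed subsets of $X$. Abstract pattern space over $(X,\Gamma)$ ($\Gamma$ acting on $X$ by homeomorphisms): a non-empty set $\Pi$ with a map $\Pi\times\mathrm{Cl}(X)\to\Pi$, $(\mathcal{P},C)\mapsto\mathcal{P}\wedge C$ and an action of $\Gamma$ on $\Pi$ such that (1) $(\mathcal{P}\wedge C_1)\wedge C_2=\mathcal{P}\wedge(C_1\cap C_2)$; (2) for each $\mathcal{P}$ there is a (unique) closed set $\operatorname{supp}\mathcal{P}$ with $\mathcal{P}\wedge C=\mathcal{P}\iff C\supset\operatorname{supp}\mathcal{P}$ for all closed $C$; (3) $(\gamma\mathcal{P})\wedge(\gamma C)=\gamma(\mathcal{P}\wedge C)$. Instances: (i) $\mathrm{UD}(X)$, the set of all uniformly discrete subsets $D$ of $X$ (for some $r>0$, $\rho(x,y)>r$ for all distinct $x,y\in D$), with $D\wedge C=D\cap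 C$ and $\gamma D=\{\gamma x\mid x\in D\}$. (ii) $C_c(X)^{*}$, the dual of the space $C_c(X)$ of compactly supported continuous complex functions with the inductive limit topology; each element $\Phi$ has the form $\Phi(\varphi)=\int_X\varphi u\,dm$ for a unique positive Borel (Radon) measure $m$ and a Borel map $u\colon X\to\{z\in\mathbb{C}:|z|=1\}$. The cutting-off is $(\Phi\wedge C)(\varphi)=\int_C\varphi u\,dm$, and the action is $(\gamma\Phi)(\varphi)=\Phi(\gamma^{-1}\varphi)$ where $(\gamma\varphi)(x)=\varphi(\gamma^{-1}x)$. Local derivability: for abstract patterns $\mathcal{P}_1,\mathcal{P}_2$ in abstract pattern spaces over $(X,\Gamma)$, $(Y,\Gamma)$ ($\Gamma$ acting by isometries on proper metric spaces), $\mathcal{P}_2$ is locally derivable from $\mathcal{P}_1$ if there are $x_0\in X$, $y_0\in Y$, $R_0\geqq0$ such that for all $\gamma,\eta\in\Gamma$, $R\geqq0$: $(\gamma\mathcal{P}_1)\wedge B(x_0,R+R_0)=(\eta\mathcal{P}_1)\wedge B(x_0,R+R_0)$ implies $(\gamma\mathcal{P}_2)\wedge B(y_0,R)=(\eta\mathcal{P}_2)\wedge B(y_0,R)$. They are mutually locally derivable if each is locally derivable from the other. *)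

theory Defs
  imports "HOL-Analysis.Analysis" "HOL-Algebra.Group_Action"
begin

section \<open>Group actions and abstract pattern spaces\<close>

definition proper_space :: "'x::metric_space itself \<Rightarrow> bool" where
  "proper_space _ \<longleftrightarrow> (\<forall>(x::'x) r. compact (cball x r))"

definition isometric_action :: "('g, 'b) monoid_scheme \<Rightarrow> ('g \<Rightarrow> 'x::metric_space \<Rightarrow> 'x) \<Rightarrow> bool" where
  "isometric_action G \<alpha> \<longleftrightarrow> group_action G UNIV \<alpha> \<and>
     (\<forall>\<gamma>\<in>carrier G. \<forall>x y. dist (\<alpha> \<gamma> x) (\<alpha> \<gamma> y) = dist x y)"

text \<open>The data of an abstract pattern space: the set of patterns, the cutting-off operation
  (meaningful on closed sets) and the group action.\<close>

record ('x, 'g, 'p) pattern_space =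
  patterns :: "'p set"
  cut :: "'p \<Rightarrow> 'x set \<Rightarrow> 'p"
  act :: "'g \<Rightarrow> 'p \<Rightarrow> 'p"

locale abstract_pattern_space =
  fixes G :: "('g, 'b) monoid_scheme"
    and \<alpha> :: "'g \<Rightarrow> 'x::topological_space \<Rightarrow> 'x"
    and S :: "('x, 'g, 'p) pattern_space"
  assumes action: "group_action G UNIV \<alpha>"
    and action_continuous: "\<gamma> \<in> carrier G \<Longrightarrow> continuous_on UNIV (\<alpha> \<gamma>)"
    and nonempty: "patterns S \<noteq> {}"
    and cut_closed: "P \<in> patterns S \<Longrightarrow> closed C \<Longrightarrow> cut S P C \<in> patterns S"
    and act_action: "group_action G (patterns S) (\<lambda>\<gamma>. restrict (act S \<gamma>) (patterns S))"
    and cut_cut: "P \<in> patterns S \<Longrightarrow> closed C1 \<Longrightarrow> closed C2 \<Longrightarrow>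
          cut S (cut S P C1) C2 = cut S P (C1 \<inter> C2)"
    and support: "P \<in> patterns S \<Longrightarrow>
          \<exists>!K. closed K \<and> (\<forall>C. closed C \<longrightarrow> (cut S P C = P \<longleftrightarrow> K \<subseteq> C))"
    and act_cut: "P \<in> patterns S \<Longrightarrow> closed C \<Longrightarrow> \<gamma> \<in> carrier G \<Longrightarrow>
          cut S (act S \<gamma> P) (\<alpha> \<gamma> ` C) = act S \<gamma> (cut S P C)"

definition locally_derivable ::
  "('g, 'b) monoid_scheme \<Rightarrow> ('x::metric_space, 'g, 'p) pattern_space \<Rightarrow> 'p \<Rightarrow>
   ('y::metric_space, 'g, 'q) pattern_space \<Rightarrow> 'q \<Rightarrow> bool" where
  \<comment> \<open>\<open>P2\<close> is locally derivable from \<open>P1\<close>\<close>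
  "locally_derivable G S1 P1 S2 P2 \<longleftrightarrow>
     (\<exists>x0 y0. \<exists>R0\<ge>0. \<forall>\<gamma>\<in>carrier G. \<forall>\<eta>\<in>carrier G. \<forall>R\<ge>0.
        cut S1 (act S1 \<gamma> P1) (cball x0 (R + R0)) = cut S1 (act S1 \<eta> P1) (cball x0 (R + R0)) \<longrightarrow>
        cut S2 (act S2 \<gamma> P2) (cball y0 R) = cut S2 (act S2 \<eta> P2) (cball y0 R))"

definition mutually_locally_derivable ::
  "('g, 'b) monoid_scheme \<Rightarrow> ('x::metric_space, 'g, 'p) pattern_space \<Rightarrow> 'p \<Rightarrow>
   ('y::metric_space, 'g, 'q) pattern_space \<Rightarrow> 'q \<Rightarrow> bool" where
  "mutually_locally_derivable G S1 P1 S2 P2 \<longleftrightarrow>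
     locally_derivable G S1 P1 S2 P2 \<and> locally_derivable G S2 P2 S1 P1"


section \<open>Uniformly discrete sets\<close>

lemma uniform_discrete_iff:
  "uniform_discrete D \<longleftrightarrow> (\<exists>r>0. \<forall>x\<in>D. \<forall>y\<in>D. x \<noteq> y \<longrightarrow> dist x y > r)"
proof
  assume "uniform_discrete D"
  then obtain e where "e > 0" and e: "\<forall>x\<in>D. \<forall>y\<in>D. dist x y < e \<longrightarrow> x = y"
    unfolding uniform_discrete_def by blast
  then have "\<forall>x\<in>D. \<forall>y\<in>D. x \<noteq> y \<longrightarrow> dist x y > e / 2"
    by fastforce
  with \<open>e > 0\<close> show "\<exists>r>0. \<forall>x\<in>D. \<forall>y\<in>D. x \<noteq> y \<longrightarrow> dist x y > r"
    by (intro exI[of _ "e / 2"]) auto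
qed (force simp: uniform_discrete_def)

definition UD :: "('g \<Rightarrow> 'x::metric_space \<Rightarrow> 'x) \<Rightarrow> ('x, 'g, 'x set) pattern_space" where
  "UD \<alpha> = \<lparr>patterns = {D. uniform_discrete D}, cut = (\<lambda>D C. D \<inter> C), act = (\<lambda>\<gamma> D. \<alpha> \<gamma> ` D)\<rparr>"

lemma UD_abstract_pattern_space:
  assumes "isometric_action G \<alpha>"
  shows "abstract_pattern_space G \<alpha> (UD \<alpha>)"
proof -
  interpret group_action G UNIV \<alpha>
    using assms by (simp add: isometric_action_def)
  interpret group G
    using group_hom by (simp add: group_hom_def)
  have iso: "dist (\<alpha> \<gamma> x) (\<alpha> \<gamma> y) = dist x y" if "\<gamma> \<in> carrier G" for \<gamma> x y
    using assms that by (simp add: isometric_action_def)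
  have comp: "\<alpha> (\<gamma> \<otimes>\<^bsub>G\<^esub> \<eta>) x = \<alpha> \<gamma> (\<alpha> \<eta> x)"
    if "\<gamma> \<in> carrier G" "\<eta> \<in> carrier G" for \<gamma> \<eta> x
    using composition_rule that by simp
  have one: "\<alpha> \<one>\<^bsub>G\<^esub> x = x" for x
    using id_eq_one by (metis UNIV_I restrict_apply')
  have inj: "inj (\<alpha> \<gamma>)" if "\<gamma> \<in> carrier G" for \<gamma>
    using inj_prop that by blast
  have ud: "uniform_discrete (\<alpha> \<gamma> ` D)" if "\<gamma> \<in> carrier G" "uniform_discrete D" for \<gamma> D
    using that iso unfolding uniform_discrete_def by (auto 4 4)
  let ?E = "{D :: 'c set. uniform_discrete D}"
  have bij: "restrict ((`) (\<alpha> \<gamma>)) ?E \<in> Bij ?E" if g: "\<gamma> \<in> carrier G" for \<gamma>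
  proof -
    have cancel: "\<alpha> \<gamma> ` \<alpha> (inv\<^bsub>G\<^esub> \<gamma>) ` D = D" "\<alpha> (inv\<^bsub>G\<^esub> \<gamma>) ` \<alpha> \<gamma> ` D = D" for D
      using g comp[of \<gamma> "inv\<^bsub>G\<^esub> \<gamma>"] comp[of "inv\<^bsub>G\<^esub> \<gamma>" \<gamma>] one by (simp_all add: image_image)
    have "bij_betw ((`) (\<alpha> \<gamma>)) ?E ?E"
      by (rule bij_betw_byWitness[where f' = "(`) (\<alpha> (inv\<^bsub>G\<^esub> \<gamma>))"]) (use g ud cancel in auto)
    then show ?thesis
      by (simp add: Bij_def bij_betw_restrict_eq)
  qed
  have "group_action G ?E (\<lambda>\<gamma>. restrict ((`) (\<alpha> \<gamma>)) ?E)"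
    unfolding group_action_def group_hom_def group_hom_axioms_def
  proof (intro conjI homI)
    show "group G" by (rule group_axioms)
    show "group (BijGroup ?E)" by (rule group_BijGroup)
    show "restrict ((`) (\<alpha> \<gamma>)) ?E \<in> carrier (BijGroup ?E)" if "\<gamma> \<in> carrier G" for \<gamma>
      using bij[OF that] by (simp add: BijGroup_def)
    show "restrict ((`) (\<alpha> (\<gamma> \<otimes>\<^bsub>G\<^esub> \<eta>))) ?E =
        restrict ((`) (\<alpha> \<gamma>)) ?E \<otimes>\<^bsub>BijGroup ?E\<^esub> restrict ((`) (\<alpha> \<eta>)) ?E"
      if "\<gamma> \<in> carrier G" "\<eta> \<in> carrier G" for \<gamma> \<eta>
      using that bij[OF that(1)] bij[OF that(2)] ud
      by (auto simp: BijGroup_def compose_def image_image comp fun_eq_iff)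
  qed
  then show ?thesis
  proof (intro abstract_pattern_space.intro, goal_cases)
    case 1
    show ?case
      using assms by (simp add: isometric_action_def)
  next
    case 2
    then show ?case
      using iso by (auto simp: continuous_on_iff)
  next
    case 3
    have "{} \<in> patterns (UD \<alpha>)"
      by (simp add: UD_def)
    then show ?case
      by blast
  next
    case (7 D)
    then have "closed D"
      by (simp add: UD_def uniform_discrete_imp_closed)
    then show ?case
      by (intro ex1I[of _ D]) (auto simp: UD_def)
  next
    case (8 D C \<gamma>)
    then show ?case
      using inj by (simp add: UD_def image_Int)
  qed (auto simp: UD_def intro: uniform_discrete_subset)
qed


section \<open>The dual of the space of compactly supported continuous functions\<close>

definition Cc :: "('x::topological_space \<Rightarrow> complex) set" where
  "Cc = {\<phi>. continuous_on UNIV \<phi> \<and> compact (closure {x. \<phi> x \<noteq> 0})}"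

definition Cc_on :: "'x::topological_space set \<Rightarrow> ('x \<Rightarrow> complex) set" where
  "Cc_on K = {\<phi>\<in>Cc. closure {x. \<phi> x \<noteq> 0} \<subseteq> K}"

text \<open>The inductive limit topology on \<^term>\<open>Cc\<close> is the finest locally convex topology for which
  the inclusions of the sup-normed spaces \<^term>\<open>Cc_on K\<close>, \<open>K\<close> compact, are continuous.
  A base of neighbourhoods of the zero function is given by the absolutely convex sets
  whose trace on each \<^term>\<open>Cc_on K\<close> is a neighbourhood of zero there.\<close>

definition Cc_zero_nhd :: "('x::topological_space \<Rightarrow> complex) set \<Rightarrow> bool" where
  "Cc_zero_nhd U \<longleftrightarrow> U \<subseteq> Cc \<and>
     (\<forall>\<phi>\<in>U. \<forall>\<psi>\<in>U. \<forall>a b. cmod a + cmod b \<le> 1 \<longrightarrow> (\<lambda>x. a * \<phi> x + b * \<psi> x) \<in> U) \<and>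
     (\<forall>K. compact K \<longrightarrow> (\<exists>e>0. {\<phi>\<in>Cc_on K. \<forall>x. cmod (\<phi> x) < e} \<subseteq> U))"

definition Cc_topology :: "('x::topological_space \<Rightarrow> complex) topology" where
  "Cc_topology = topology (\<lambda>W. W \<subseteq> Cc \<and>
     (\<forall>\<phi>\<in>W. \<exists>U. Cc_zero_nhd U \<and> (\<lambda>\<psi> x. \<phi> x + \<psi> x) ` U \<subseteq> W))"

lemma openin_Cc_topology:
  fixes W :: "('x::topological_space \<Rightarrow> complex) set"
  shows "openin Cc_topology W \<longleftrightarrow> W \<subseteq> Cc \<and>
     (\<forall>\<phi>\<in>W. \<exists>U. Cc_zero_nhd U \<and> (\<lambda>\<psi> x. \<phi> x + \<psi> x) ` U \<subseteq> W)"
proof -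
  have nhd_Int: "Cc_zero_nhd (U \<inter> V)"
    if U: "Cc_zero_nhd U" and V: "Cc_zero_nhd V" for U V :: "('x \<Rightarrow> complex) set"
    unfolding Cc_zero_nhd_def
  proof (intro conjI allI impI)
    fix K :: "'x set" assume K: "compact K"
    obtain d where d: "d > 0" "{\<phi>\<in>Cc_on K. \<forall>x. cmod (\<phi> x) < d} \<subseteq> U"
      using U K unfolding Cc_zero_nhd_def by blast
    obtain e where e: "e > 0" "{\<phi>\<in>Cc_on K. \<forall>x. cmod (\<phi> x) < e} \<subseteq> V"
      using V K unfolding Cc_zero_nhd_def by blast
    show "\<exists>e>0. {\<phi>\<in>Cc_on K. \<forall>x. cmod (\<phi> x) < e} \<subseteq> U \<inter> V"
      using d e by (intro exI[of _ "min d e"]) auto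
  qed (use U V in \<open>auto simp: Cc_zero_nhd_def\<close>)
  have "istopology (\<lambda>W::('x \<Rightarrow> complex) set. W \<subseteq> Cc \<and>
     (\<forall>\<phi>\<in>W. \<exists>U. Cc_zero_nhd U \<and> (\<lambda>\<psi> x. \<phi> x + \<psi> x) ` U \<subseteq> W))"
    unfolding istopology_def
  proof (intro conjI allI impI ballI)
    fix S T :: "('x \<Rightarrow> complex) set" and \<phi>
    assume S: "S \<subseteq> Cc \<and> (\<forall>\<phi>\<in>S. \<exists>U. Cc_zero_nhd U \<and> (\<lambda>\<psi> x. \<phi> x + \<psi> x) ` U \<subseteq> S)"
      and T: "T \<subseteq> Cc \<and> (\<forall>\<phi>\<in>T. \<exists>U. Cc_zero_nhd U \<and> (\<lambda>\<psi> x. \<phi> x + \<psi> x) ` U \<subseteq> T)"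
      and \<phi>: "\<phi> \<in> S \<inter> T"
    from S \<phi> obtain U where U: "Cc_zero_nhd U" "(\<lambda>\<psi> x. \<phi> x + \<psi> x) ` U \<subseteq> S" by blast
    from T \<phi> obtain V where V: "Cc_zero_nhd V" "(\<lambda>\<psi> x. \<phi> x + \<psi> x) ` V \<subseteq> T" by blast
    show "\<exists>U. Cc_zero_nhd U \<and> (\<lambda>\<psi> x. \<phi> x + \<psi> x) ` U \<subseteq> S \<inter> T"
      using nhd_Int[OF U(1) V(1)] U(2) V(2) by (intro exI[of _ "U \<inter> V"]) auto
  next
    fix \<K> :: "('x \<Rightarrow> complex) set set" and \<phi>
    assume \<K>: "\<forall>S\<in>\<K>. S \<subseteq> Cc \<and> (\<forall>\<phi>\<in>S. \<exists>U. Cc_zero_nhd U \<and> (\<lambda>\<psi> x. \<phi> x + \<psi> x) ` U \<subseteq> S)"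
      and "\<phi> \<in> \<Union>\<K>"
    then obtain S where S: "S \<in> \<K>" "\<phi> \<in> S" by blast
    with \<K> obtain U where "Cc_zero_nhd U" "(\<lambda>\<psi> x. \<phi> x + \<psi> x) ` U \<subseteq> S" by blast
    with S show "\<exists>U. Cc_zero_nhd U \<and> (\<lambda>\<psi> x. \<phi> x + \<psi> x) ` U \<subseteq> \<Union>\<K>" by blast
  qed auto
  then show ?thesis
    unfolding Cc_topology_def by (simp only: topology_inverse')
qed

lemma Cc_linear:
  fixes \<phi> \<psi> :: "'x::topological_space \<Rightarrow> complex"
  assumes "\<phi> \<in> Cc" "\<psi> \<in> Cc"
  shows "(\<lambda>x. a * \<phi> x + b * \<psi> x) \<in> Cc"
proof -
  have "{x. a * \<phi> x + b * \<psi> x \<noteq> 0} \<subseteq> {x. \<phi> x \<noteq> 0} \<union> {x. \<psi> x \<noteq> 0}"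
    by auto
  then have "closure {x. a * \<phi> x + b * \<psi> x \<noteq> 0} \<subseteq> closure {x. \<phi> x \<noteq> 0} \<union> closure {x. \<psi> x \<noteq> 0}"
    using closure_mono by (simp add: closure_mono flip: closure_Un)
  moreover have "compact (closure {x. \<phi> x \<noteq> 0} \<union> closure {x. \<psi> x \<noteq> 0})"
    using assms by (auto simp: Cc_def)
  ultimately have "compact (closure {x. a * \<phi> x + b * \<psi> x \<noteq> 0})"
    using compact_Int_closed[OF _ closed_closure, of "closure {x. \<phi> x \<noteq> 0} \<union> closure {x. \<psi> x \<noteq> 0}"
        "{x. a * \<phi> x + b * \<psi> x \<noteq> 0}"]
    by (simp only: Int_absorb1)
  then show ?thesis
    using assms by (auto simp: Cc_def intro!: continuous_intros)
qed

lemma topspace_Cc_topology [simp]: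
  "topspace Cc_topology = (Cc :: ('x::topological_space \<Rightarrow> complex) set)"
proof
  show "topspace Cc_topology \<subseteq> (Cc :: ('x \<Rightarrow> complex) set)"
    using openin_Cc_topology openin_topspace by blast
  have "Cc_zero_nhd (Cc :: ('x \<Rightarrow> complex) set)"
    unfolding Cc_zero_nhd_def using Cc_linear by (force simp: Cc_on_def intro: exI[of _ 1])
  moreover have "(\<lambda>\<psi> x. \<phi> x + \<psi> x) ` Cc \<subseteq> (Cc :: ('x \<Rightarrow> complex) set)" if "\<phi> \<in> Cc" for \<phi>
    using Cc_linear[OF that, of _ 1 1] by auto
  ultimately have "openin Cc_topology (Cc :: ('x \<Rightarrow> complex) set)"
    unfolding openin_Cc_topology by blast
  then show "(Cc :: ('x \<Rightarrow> complex) set) \<subseteq> topspace Cc_topology"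
    by (rule openin_subset)
qed

text \<open>Functionals are taken to be extensional on \<^term>\<open>Cc\<close>, so that equality of functionals is
  equality of HOL functions.\<close>

definition Cc_dual :: "(('x::topological_space \<Rightarrow> complex) \<Rightarrow> complex) set" where
  "Cc_dual = {\<Phi> \<in> extensional Cc.
     (\<forall>\<phi>\<in>Cc. \<forall>\<psi>\<in>Cc. \<forall>a b. \<Phi> (\<lambda>x. a * \<phi> x + b * \<psi> x) = a * \<Phi> \<phi> + b * \<Phi> \<psi>) \<and>
     continuous_map Cc_topology euclidean \<Phi>}"

definition radon_measure :: "'x::topological_space measure \<Rightarrow> bool" where
  "radon_measure m \<longleftrightarrow> sets m = sets borel \<and>
     (\<forall>K. compact K \<longrightarrow> emeasure m K < \<infinity>) \<and>
     (\<forall>B\<in>sets borel. emeasure m B = (INF U\<in>{U. open U \<and> B \<subseteq> U}. emeasure m U)) \<and>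
     (\<forall>U. open U \<longrightarrow> emeasure m U = (SUP K\<in>{K. compact K \<and> K \<in> sets borel \<and> K \<subseteq> U}. emeasure m K))"

definition polar_rep ::
  "(('x::topological_space \<Rightarrow> complex) \<Rightarrow> complex) \<Rightarrow> 'x measure \<Rightarrow> ('x \<Rightarrow> complex) \<Rightarrow> bool" where
  "polar_rep \<Phi> m u \<longleftrightarrow> radon_measure m \<and> u \<in> borel_measurable borel \<and> (\<forall>x. cmod (u x) = 1) \<and>
     (\<forall>\<phi>\<in>Cc. \<Phi> \<phi> = (LINT x|m. \<phi> x * u x))"

text \<open>By the Riesz representation theorem every element of \<^term>\<open>Cc_dual\<close> over a proper metric
  space has a polar representation; \<open>m\<close> is unique and \<open>u\<close> is unique up to \<open>m\<close>-null sets.  The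
  choice of a representation does not matter, see \<open>cut_dual_eq\<close> below.\<close>

definition cut_dual ::
  "(('x::topological_space \<Rightarrow> complex) \<Rightarrow> complex) \<Rightarrow> 'x set \<Rightarrow> ('x \<Rightarrow> complex) \<Rightarrow> complex" where
  "cut_dual \<Phi> C = (let (m, u) = (SOME (m, u). polar_rep \<Phi> m u)
                   in (\<lambda>\<phi>\<in>Cc. LINT x:C|m. \<phi> x * u x))"

definition act_fun ::
  "('g, 'b) monoid_scheme \<Rightarrow> ('g \<Rightarrow> 'x \<Rightarrow> 'x) \<Rightarrow> 'g \<Rightarrow> ('x \<Rightarrow> complex) \<Rightarrow> 'x \<Rightarrow> complex" where
  "act_fun G \<alpha> \<gamma> \<phi> = (\<lambda>x. \<phi> (\<alpha> (inv\<^bsub>G\<^esub> \<gamma>) x))"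

definition act_dual ::
  "('g, 'b) monoid_scheme \<Rightarrow> ('g \<Rightarrow> 'x::topological_space \<Rightarrow> 'x) \<Rightarrow> 'g \<Rightarrow>
   (('x \<Rightarrow> complex) \<Rightarrow> complex) \<Rightarrow> ('x \<Rightarrow> complex) \<Rightarrow> complex" where
  "act_dual G \<alpha> \<gamma> \<Phi> = (\<lambda>\<phi>\<in>Cc. \<Phi> (act_fun G \<alpha> (inv\<^bsub>G\<^esub> \<gamma>) \<phi>))"

definition CcDual ::
  "('g, 'b) monoid_scheme \<Rightarrow> ('g \<Rightarrow> 'x::metric_space \<Rightarrow> 'x) \<Rightarrow>
   ('x, 'g, ('x \<Rightarrow> complex) \<Rightarrow> complex) pattern_space" where
  "CcDual G \<alpha> = \<lparr>patterns = Cc_dual, cut = cut_dual, act = act_dual G \<alpha>\<rparr>"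


section \<open>Dirac measures and sums in the vague topology\<close>

definition dirac :: "'x::topological_space \<Rightarrow> ('x \<Rightarrow> complex) \<Rightarrow> complex" where
  "dirac x = (\<lambda>\<phi>\<in>Cc. \<phi> x)"

definition vague_topology :: "(('x::topological_space \<Rightarrow> complex) \<Rightarrow> complex) topology" where
  "vague_topology = subtopology (product_topology (\<lambda>_. euclidean) Cc) Cc_dual"

definition has_vague_sum ::
  "('i \<Rightarrow> ('x::topological_space \<Rightarrow> complex) \<Rightarrow> complex) \<Rightarrow> 'i set \<Rightarrow>
   (('x \<Rightarrow> complex) \<Rightarrow> complex) \<Rightarrow> bool" where
  "has_vague_sum f A \<Phi> \<longleftrightarrow>
     limitin vague_topology (\<lambda>F. \<lambda>\<phi>\<in>Cc. \<Sum>i\<in>F. f i \<phi>) \<Phi> (finite_subsets_at_top A)"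

definition vague_sum ::
  "('i \<Rightarrow> ('x::topological_space \<Rightarrow> complex) \<Rightarrow> complex) \<Rightarrow> 'i set \<Rightarrow>
   ('x \<Rightarrow> complex) \<Rightarrow> complex" where
  "vague_sum f A = (THE \<Phi>. has_vague_sum f A \<Phi>)"

lemma has_vague_sum_unique:
  fixes f :: "'i \<Rightarrow> ('x::topological_space \<Rightarrow> complex) \<Rightarrow> complex"
  assumes "has_vague_sum f A \<Phi>" "has_vague_sum f A \<Psi>"
  shows "\<Phi> = \<Psi>"
proof -
  have "Hausdorff_space (vague_topology :: (('x \<Rightarrow> complex) \<Rightarrow> complex) topology)"
    unfolding vague_topology_def
    by (intro Hausdorff_space_subtopology) (simp add: Hausdorff_space_product_topology)
  then show ?thesis
    using assms unfolding has_vague_sum_def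
    by (auto intro: limitin_Hausdorff_unique)
qed

lemma vague_sum_eqI: "has_vague_sum f A \<Phi> \<Longrightarrow> vague_sum f A = \<Phi>"
  unfolding vague_sum_def using has_vague_sum_unique by blast


section \<open>Well-definedness of the cutting-off\<close>

lemma polar_rep_cut:
  fixes \<Phi> :: "('x::metric_space \<Rightarrow> complex) \<Rightarrow> complex"
  assumes mu: "polar_rep \<Phi> m u" and C: "closed C" "C \<noteq> {}" and \<phi>: "\<phi> \<in> Cc"
  shows "(\<lambda>n. \<Phi> (\<lambda>x. of_real (max 0 (1 - real n * infdist x C)) * \<phi> x))
           \<longlonglongrightarrow> (LINT x:C|m. \<phi> x * u x)"
proof -
  define g where "g = (\<lambda>n x. max 0 (1 - real n * infdist x C))"
  have g_cont: "continuous_on UNIV (g n)" for n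
    unfolding g_def by (intro continuous_intros)
  have g_bound: "0 \<le> g n x" "g n x \<le> 1" for n x
    unfolding g_def by (auto simp: infdist_nonneg)
  have \<phi>_cont: "continuous_on UNIV \<phi>" and supp: "compact (closure {x. \<phi> x \<noteq> 0})"
    using \<phi> by (auto simp: Cc_def)
  have sets_m: "sets m = sets borel" and u: "u \<in> borel_measurable borel" "\<And>x. cmod (u x) = 1"
    and fin: "emeasure m (closure {x. \<phi> x \<noteq> 0}) < \<infinity>"
    using mu supp unfolding polar_rep_def radon_measure_def by blast+
  have g\<phi>: "(\<lambda>x. of_real (g n x) * \<phi> x) \<in> Cc" for n
  proof -
    have "closure {x. of_real (g n x) * \<phi> x \<noteq> 0} \<subseteq> closure {x. \<phi> x \<noteq> 0}"
      by (intro closure_mono) auto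
    then have "compact (closure {x. of_real (g n x) * \<phi> x \<noteq> 0})"
      using compact_Int_closed[OF supp closed_closure, of "{x. of_real (g n x) * \<phi> x \<noteq> 0}"]
      by (simp only: Int_absorb1)
    then show ?thesis
      using \<phi>_cont g_cont[of n] by (auto simp: Cc_def intro!: continuous_intros)
  qed
  have [measurable]: "\<phi> \<in> borel_measurable m" "g n \<in> borel_measurable m" "u \<in> borel_measurable m" for n
    using \<phi>_cont g_cont[of n] u sets_m
    by (auto simp: measurable_cong_sets[OF sets_m refl] intro: borel_measurable_continuous_onI)
  have [measurable]: "C \<in> sets m" "closure {x. \<phi> x \<noteq> 0} \<in> sets m"
    using C sets_m by auto
  have "bounded (\<phi> ` closure {x. \<phi> x \<noteq> 0})"
    by (intro compact_imp_bounded compact_continuous_image supp continuous_on_subset[OF \<phi>_cont]) auto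
  then obtain B where B: "\<And>x. x \<in> closure {x. \<phi> x \<noteq> 0} \<Longrightarrow> cmod (\<phi> x) \<le> B"
    unfolding bounded_iff by blast
  have \<phi>_bound: "cmod (\<phi> x) \<le> indicator (closure {x. \<phi> x \<noteq> 0}) x * B" for x
  proof (cases "\<phi> x = 0")
    case True
    then show ?thesis using B[of x] by (auto simp: indicator_def)
  next
    case False
    then have "x \<in> closure {x. \<phi> x \<noteq> 0}"
      using closure_subset by fastforce
    then show ?thesis using B by auto
  qed
  have g_lim: "(\<lambda>n. g n x) \<longlonglongrightarrow> indicator C x" for x
  proof (cases "x \<in> C")
    case True
    then show ?thesis by (auto simp: g_def)
  next
    case False
    then have pos: "infdist x C > 0"
      using C infdist_nonneg[of x C] by (metis in_closed_iff_infdist_zero less_eq_real_def)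
    have "\<forall>\<^sub>F n in sequentially. g n x = 0"
    proof (rule eventually_sequentiallyI)
      fix n assume "n \<ge> nat \<lceil>1 / infdist x C\<rceil>"
      then have "1 / infdist x C \<le> real n" by linarith
      then show "g n x = 0" using pos by (auto simp: g_def field_simps max_def)
    qed
    then show ?thesis using False by (auto intro: tendsto_eventually)
  qed
  have "(\<lambda>n. LINT x|m. of_real (g n x) * \<phi> x * u x) \<longlonglongrightarrow> (LINT x|m. indicator C x *\<^sub>R (\<phi> x * u x))"
  proof (rule integral_dominated_convergence
      [where w = "\<lambda>x. indicator (closure {x. \<phi> x \<noteq> 0}) x * B"])
    show "integrable m (\<lambda>x. indicator (closure {x. \<phi> x \<noteq> 0}) x * B)"
      using fin by (intro integrable_mult_left) auto
    show "AE x in m. (\<lambda>n. of_real (g n x) * \<phi> x * u x) \<longlonglongrightarrow> indicator C x *\<^sub>R (\<phi> x * u x)"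
    proof (rule AE_I2)
      fix x
      have "(\<lambda>n. of_real (g n x) * (\<phi> x * u x)) \<longlonglongrightarrow> of_real (indicator C x) * (\<phi> x * u x)"
        by (intro tendsto_intros g_lim)
      then show "(\<lambda>n. of_real (g n x) * \<phi> x * u x) \<longlonglongrightarrow> indicator C x *\<^sub>R (\<phi> x * u x)"
        by (simp add: scaleR_conv_of_real mult.assoc)
    qed
    show "AE x in m. norm (of_real (g n x) * \<phi> x * u x) \<le> indicator (closure {x. \<phi> x \<noteq> 0}) x * B" for n
    proof (rule AE_I2)
      fix x
      have "norm (of_real (g n x) * \<phi> x * u x) = g n x * cmod (\<phi> x)"
        using g_bound u by (simp add: norm_mult)
      also have "\<dots> \<le> cmod (\<phi> x)"
        using g_bound by (intro mult_left_le_one_le) auto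
      finally show "norm (of_real (g n x) * \<phi> x * u x) \<le> indicator (closure {x. \<phi> x \<noteq> 0}) x * B"
        using \<phi>_bound[of x] by linarith
    qed
  qed measurable
  moreover have "\<Phi> (\<lambda>x. of_real (g n x) * \<phi> x) = (LINT x|m. of_real (g n x) * \<phi> x * u x)" for n
    using mu g\<phi>[of n] by (simp add: polar_rep_def)
  ultimately show ?thesis
    by (simp add: g_def set_lebesgue_integral_def)
qed

lemma cut_dual_eq:
  fixes \<Phi> :: "('x::metric_space \<Rightarrow> complex) \<Rightarrow> complex"
  assumes mu: "polar_rep \<Phi> m u" and C: "closed C"
  shows "cut_dual \<Phi> C = (\<lambda>\<phi>\<in>Cc. LINT x:C|m. \<phi> x * u x)"
proof -
  obtain m' u' where eq: "(SOME (m, u). polar_rep \<Phi> m u) = (m', u')"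
    by fastforce
  have mu': "polar_rep \<Phi> m' u'"
    using someI[of "\<lambda>(m, u). polar_rep \<Phi> m u" "(m, u)"] mu eq by auto
  have "(LINT x:C|m'. \<phi> x * u' x) = (LINT x:C|m. \<phi> x * u x)" if "\<phi> \<in> Cc" for \<phi>
  proof (cases "C = {}")
    case True
    then show ?thesis by (simp add: set_lebesgue_integral_def)
  next
    case False
    show ?thesis
      using polar_rep_cut[OF mu' C False that] polar_rep_cut[OF mu C False that]
      by (rule LIMSEQ_unique)
  qed
  then show ?thesis
    by (auto simp: cut_dual_def eq)
qed

end

theory Submission
  imports Defs
begin

text \<open>A uniformly discrete set \<open>D\<close> meets every compact set in finitely many points, so for
  \<open>\<phi>\<close> of compact support the sum \<open>\<Sum>x\<in>D. \<phi> x\<close> has only finitely many non-zero terms.  The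
  functional \<open>dirac_comb D\<close> given by this sum is the vague sum of the Dirac measures at the points of
  \<open>D\<close>: every finite subset of \<open>D\<close> that contains the finitely many points of \<open>D\<close> at which \<open>\<phi>\<close>
  does not vanish already yields the limiting value at \<open>\<phi>\<close>.

  The polar representation of \<open>dirac_comb D\<close> consists of the counting measure of \<open>D\<close> and the
  constant function \<open>1\<close> (\<open>polar_rep_dirac_comb\<close>).  Cutting off by \<open>C\<close> therefore restricts the
  counting measure of \<open>D\<close> to \<open>C\<close>, which gives the counting measure of \<open>D \<inter> C\<close>; and letting
  \<open>\<gamma>\<close> act amounts to reindexing the sum along \<open>x \<mapsto> \<gamma> x\<close>.

  Thus the map \<open>D \<mapsto> dirac_comb D\<close> commutes with cutting-off and with the group action.  Over a
  proper space it is moreover injective (\<open>dirac_comb_inject\<close>), because a tent function of small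
  support detects whether a given point belongs to \<open>D\<close>.  So the patches of \<open>\<mu>\<close> and of \<open>D\<close> on any
  ball determine each other, and the two patterns are mutually locally derivable with any common
  base point and \<open>R\<^sub>0 = 0\<close>.\<close>

section \<open>Uniformly discrete sets and the combs they carry\<close>

lemma finite_uniform_discrete_Int_compact:
  assumes "uniform_discrete D" "compact K"
  shows "finite (D \<inter> K)"
proof -
  have "uniform_discrete (D \<inter> K)"
    using assms(1) by (rule uniform_discrete_subset) simp
  then have "discrete (D \<inter> K)"
    by (rule uniform_discrete_imp_discrete)
  moreover have "compact (D \<inter> K)"
    using assms by (simp add: closed_Int_compact uniform_discrete_imp_closed)
  ultimately show ?thesis
    using discrete_compact_finite_iff by blast
qed

lemma finite_imp_uniform_discrete:
  fixes F :: "'x::metric_space set"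
  assumes "finite F"
  shows "uniform_discrete F"
proof (cases "F = {}")
  case False
  have "\<forall>x. \<exists>d>0. \<forall>y\<in>F. y \<noteq> x \<longrightarrow> d \<le> dist x y"
    using finite_set_avoid[OF assms] by blast
  then obtain d where d: "\<And>x. 0 < d x" "\<And>x y. y \<in> F \<Longrightarrow> y \<noteq> x \<Longrightarrow> d x \<le> dist x y"
    by metis
  have "dist x y < Min (d ` F) \<Longrightarrow> x = y" if "x \<in> F" "y \<in> F" for x y
    using that d(2)[of y x] Min_le[of "d ` F" "d x"] assms by fastforce
  moreover have "Min (d ` F) > 0"
    using assms False d(1) by simp
  ultimately show ?thesis
    unfolding uniform_discrete_def by blast
qed simp

text \<open>The sum is restricted to the points at which \<open>\<phi>\<close> does not vanish because a sum over an
  infinite index set has the default value \<open>0\<close>.\<close>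

definition dirac_comb :: "'x::topological_space set \<Rightarrow> ('x \<Rightarrow> complex) \<Rightarrow> complex" where
  "dirac_comb D = (\<lambda>\<phi>\<in>Cc. \<Sum>x | x \<in> D \<and> \<phi> x \<noteq> 0. \<phi> x)"

lemma dirac_comb_eq_sum:
  assumes "\<phi> \<in> Cc" "finite F" "F \<subseteq> D" "\<And>x. x \<in> D \<Longrightarrow> \<phi> x \<noteq> 0 \<Longrightarrow> x \<in> F"
  shows "dirac_comb D \<phi> = sum \<phi> F"
proof -
  have "(\<Sum>x | x \<in> D \<and> \<phi> x \<noteq> 0. \<phi> x) = sum \<phi> F"
    using assms by (intro sum.mono_neutral_left) auto
  then show ?thesis
    using assms(1) by (simp add: dirac_comb_def)
qed

lemma finite_uniform_discrete_support:
  fixes \<phi> :: "'x::metric_space \<Rightarrow> complex"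
  assumes "uniform_discrete D" "\<phi> \<in> Cc"
  shows "finite {x \<in> D. \<phi> x \<noteq> 0}"
proof (rule finite_subset)
  show "{x \<in> D. \<phi> x \<noteq> 0} \<subseteq> D \<inter> closure {x. \<phi> x \<noteq> 0}"
    using closure_subset by fastforce
  show "finite (D \<inter> closure {x. \<phi> x \<noteq> 0})"
    using assms by (intro finite_uniform_discrete_Int_compact) (auto simp: Cc_def)
qed


section \<open>Continuity for the inductive limit topology\<close>

text \<open>The inductive limit topology is designed for this criterion: a linear functional is continuous
  as soon as it is bounded on each of the sup-normed spaces \<^term>\<open>Cc_on K\<close>, because then the
  absolutely convex sets \<open>{\<psi>. cmod (\<Phi> \<psi>) < e}\<close> are neighbourhoods of zero.\<close>

lemma Cc_dualI:
  fixes \<Phi> :: "('x::topological_space \<Rightarrow> complex) \<Rightarrow> complex"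
  assumes ext: "\<Phi> \<in> extensional Cc"
    and lin: "\<And>\<phi> \<psi> a b. \<phi> \<in> Cc \<Longrightarrow> \<psi> \<in> Cc \<Longrightarrow> \<Phi> (\<lambda>x. a * \<phi> x + b * \<psi> x) = a * \<Phi> \<phi> + b * \<Phi> \<psi>"
    and bound: "\<And>K. compact K \<Longrightarrow> \<exists>B. \<forall>\<phi>\<in>Cc_on K. \<forall>e. (\<forall>x. cmod (\<phi> x) \<le> e) \<longrightarrow> cmod (\<Phi> \<phi>) \<le> B * e"
  shows "\<Phi> \<in> Cc_dual"
proof -
  have nhd: "Cc_zero_nhd {\<psi> \<in> Cc. cmod (\<Phi> \<psi>) < e}" if "e > 0" for e
    unfolding Cc_zero_nhd_def
  proof (intro conjI ballI allI impI)
    fix \<phi> \<psi> and a b :: complex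
    assume \<phi>: "\<phi> \<in> {\<psi> \<in> Cc. cmod (\<Phi> \<psi>) < e}" and \<psi>: "\<psi> \<in> {\<psi> \<in> Cc. cmod (\<Phi> \<psi>) < e}"
      and ab: "cmod a + cmod b \<le> 1"
    define s where "s = max (cmod (\<Phi> \<phi>)) (cmod (\<Phi> \<psi>))"
    have s: "0 \<le> s" "s < e" "cmod (\<Phi> \<phi>) \<le> s" "cmod (\<Phi> \<psi>) \<le> s"
      using \<phi> \<psi> by (auto simp: s_def le_max_iff_disj)
    have "cmod (a * \<Phi> \<phi> + b * \<Phi> \<psi>) \<le> cmod a * cmod (\<Phi> \<phi>) + cmod b * cmod (\<Phi> \<psi>)"
      by (metis norm_mult norm_triangle_ineq)
    also have "\<dots> \<le> cmod a * s + cmod b * s"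
      using s by (intro add_mono mult_left_mono) auto
    also have "\<dots> = (cmod a + cmod b) * s"
      by (simp add: algebra_simps)
    also have "\<dots> \<le> 1 * s"
      using s ab by (intro mult_right_mono)
    also have "1 * s < e"
      using s by simp
    finally have "cmod (a * \<Phi> \<phi> + b * \<Phi> \<psi>) < e" .
    then show "(\<lambda>x. a * \<phi> x + b * \<psi> x) \<in> {\<psi> \<in> Cc. cmod (\<Phi> \<psi>) < e}"
      using lin[of \<phi> \<psi> a b] Cc_linear[of \<phi> \<psi> a b] \<phi> \<psi> by simp
  next
    fix K :: "'x set" assume "compact K"
    then obtain B where B: "\<forall>\<phi>\<in>Cc_on K. \<forall>d. (\<forall>x. cmod (\<phi> x) \<le> d) \<longrightarrow> cmod (\<Phi> \<phi>) \<le> B * d"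
      using bound[of K] by auto
    define d where "d = e / (\<bar>B\<bar> + 1)"
    have "d > 0"
      using \<open>e > 0\<close> by (simp add: d_def)
    moreover have "B * d < (\<bar>B\<bar> + 1) * d"
      using \<open>d > 0\<close> by (intro mult_strict_right_mono) auto
    ultimately have d: "d > 0" "B * d < e"
      by (simp_all add: d_def)
    have "cmod (\<Phi> \<phi>) < e" if "\<phi> \<in> Cc_on K" "\<forall>x. cmod (\<phi> x) < d" for \<phi>
    proof -
      have "cmod (\<Phi> \<phi>) \<le> B * d"
        using that by (intro B[rule_format]) (auto intro: less_imp_le)
      then show ?thesis
        using d(2) by simp
    qed
    with d(1) show "\<exists>d>0. {\<phi> \<in> Cc_on K. \<forall>x. cmod (\<phi> x) < d} \<subseteq> {\<psi> \<in> Cc. cmod (\<Phi> \<psi>) < e}"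
      by (intro exI[of _ d]) (auto simp: Cc_on_def)
  qed auto
  have "openin Cc_topology {\<phi> \<in> Cc. \<Phi> \<phi> \<in> W}" if "open W" for W
    unfolding openin_Cc_topology
  proof (intro conjI ballI)
    fix \<phi> assume \<phi>: "\<phi> \<in> {\<phi> \<in> Cc. \<Phi> \<phi> \<in> W}"
    then obtain e where e: "e > 0" "ball (\<Phi> \<phi>) e \<subseteq> W"
      using \<open>open W\<close> open_contains_ball by blast
    have "(\<lambda>x. \<phi> x + \<psi> x) \<in> {\<phi> \<in> Cc. \<Phi> \<phi> \<in> W}" if \<psi>: "\<psi> \<in> Cc" "cmod (\<Phi> \<psi>) < e" for \<psi>
    proof -
      have "\<Phi> (\<lambda>x. \<phi> x + \<psi> x) = \<Phi> \<phi> + \<Phi> \<psi>" "(\<lambda>x. \<phi> x + \<psi> x) \<in> Cc"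
        using lin[of \<phi> \<psi> 1 1] Cc_linear[of \<phi> \<psi> 1 1] \<phi> \<psi> by auto
      then show ?thesis
        using e(2) \<psi>(2) by (auto simp: dist_norm)
    qed
    with nhd[OF e(1)]
    show "\<exists>U. Cc_zero_nhd U \<and> (\<lambda>\<psi> x. \<phi> x + \<psi> x) ` U \<subseteq> {\<phi> \<in> Cc. \<Phi> \<phi> \<in> W}"
      by (intro exI[of _ "{\<psi> \<in> Cc. cmod (\<Phi> \<psi>) < e}"]) auto
  qed auto
  then have "continuous_map Cc_topology euclidean \<Phi>"
    by (simp add: continuous_map_def)
  then show ?thesis
    unfolding Cc_dual_def by (intro CollectI conjI ballI allI ext lin)
qed

lemma dirac_comb_in_Cc_dual:
  fixes D :: "'x::metric_space set"
  assumes D: "uniform_discrete D"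
  shows "dirac_comb D \<in> Cc_dual"
proof (rule Cc_dualI)
  show "dirac_comb D \<in> extensional Cc"
    by (simp add: dirac_comb_def)
next
  fix \<phi> \<psi> :: "'x \<Rightarrow> complex" and a b
  assume \<phi>: "\<phi> \<in> Cc" and \<psi>: "\<psi> \<in> Cc"
  define F where "F = {x \<in> D. \<phi> x \<noteq> 0} \<union> {x \<in> D. \<psi> x \<noteq> 0}"
  have F: "finite F" "F \<subseteq> D"
    using finite_uniform_discrete_support[OF D] \<phi> \<psi> by (auto simp: F_def)
  have "dirac_comb D (\<lambda>x. a * \<phi> x + b * \<psi> x) = (\<Sum>x\<in>F. a * \<phi> x + b * \<psi> x)"
    by (rule dirac_comb_eq_sum) (use F \<phi> \<psi> in \<open>auto simp: F_def intro: Cc_linear\<close>)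
  moreover have "dirac_comb D \<phi> = sum \<phi> F" "dirac_comb D \<psi> = sum \<psi> F"
    by (rule dirac_comb_eq_sum; use F \<phi> \<psi> in \<open>auto simp: F_def\<close>)+
  ultimately show "dirac_comb D (\<lambda>x. a * \<phi> x + b * \<psi> x) = a * dirac_comb D \<phi> + b * dirac_comb D \<psi>"
    by (simp add: sum.distrib sum_distrib_left)
next
  fix K :: "'x set" assume "compact K"
  then have fin: "finite (D \<inter> K)"
    using D by (simp add: finite_uniform_discrete_Int_compact)
  have "cmod (dirac_comb D \<phi>) \<le> real (card (D \<inter> K)) * e"
    if "\<phi> \<in> Cc_on K" and e: "\<forall>x. cmod (\<phi> x) \<le> e" for \<phi> e
  proof -
    have \<phi>: "\<phi> \<in> Cc" "closure {x. \<phi> x \<noteq> 0} \<subseteq> K"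
      using that by (auto simp: Cc_on_def)
    then have "dirac_comb D \<phi> = sum \<phi> (D \<inter> K)"
      using fin closure_subset[of "{x. \<phi> x \<noteq> 0}"] by (intro dirac_comb_eq_sum) auto
    then show ?thesis
      using sum_norm_bound[of "D \<inter> K" \<phi> e] e by simp
  qed
  then show "\<exists>B. \<forall>\<phi>\<in>Cc_on K. \<forall>e. (\<forall>x. cmod (\<phi> x) \<le> e) \<longrightarrow> cmod (dirac_comb D \<phi>) \<le> B * e"
    by (intro exI[of _ "real (card (D \<inter> K))"]) simp
qed


section \<open>The comb as a vague sum of Dirac measures\<close>

lemma has_vague_sum_dirac_comb:
  fixes D :: "'x::metric_space set"
  assumes D: "uniform_discrete D"
  shows "has_vague_sum dirac D (dirac_comb D)"
proof -
  have partial: "(\<lambda>\<phi>\<in>Cc. \<Sum>x\<in>F. dirac x \<phi>) = dirac_comb F" if "finite F" for F :: "'x set"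
  proof (rule extensionalityI[where A = Cc])
    show "(\<lambda>\<phi>\<in>Cc. \<Sum>x\<in>F. dirac x \<phi>) \<phi> = dirac_comb F \<phi>" if "\<phi> \<in> Cc" for \<phi>
      using that \<open>finite F\<close> by (simp add: dirac_def dirac_comb_eq_sum[of \<phi> F F])
  qed (simp_all add: dirac_comb_def)
  have ev_dual: "\<forall>\<^sub>F F in finite_subsets_at_top D. (\<lambda>\<phi>\<in>Cc. \<Sum>x\<in>F. dirac x \<phi>) \<in> Cc_dual"
    by (rule eventually_finite_subsets_at_top_weakI)
      (simp add: partial dirac_comb_in_Cc_dual finite_imp_uniform_discrete)
  have "limitin euclidean (\<lambda>F. (\<lambda>\<phi>\<in>Cc. \<Sum>x\<in>F. dirac x \<phi>) \<phi>) (dirac_comb D \<phi>) (finite_subsets_at_top D)"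
    if \<phi>: "\<phi> \<in> Cc" for \<phi>
  proof -
    have "\<forall>\<^sub>F F in finite_subsets_at_top D. (\<lambda>\<phi>\<in>Cc. \<Sum>x\<in>F. dirac x \<phi>) \<phi> = dirac_comb D \<phi>"
      unfolding eventually_finite_subsets_at_top
    proof (intro exI conjI allI impI)
      show "finite {x \<in> D. \<phi> x \<noteq> 0}"
        using D \<phi> by (rule finite_uniform_discrete_support)
      fix F assume "finite F \<and> {x \<in> D. \<phi> x \<noteq> 0} \<subseteq> F \<and> F \<subseteq> D"
      then have "dirac_comb D \<phi> = sum \<phi> F"
        using \<phi> by (intro dirac_comb_eq_sum) auto
      then show "(\<lambda>\<phi>\<in>Cc. \<Sum>x\<in>F. dirac x \<phi>) \<phi> = dirac_comb D \<phi>"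
        using \<phi> by (simp add: dirac_def)
    qed auto
    then show ?thesis
      by (simp add: tendsto_eventually)
  qed
  then show ?thesis
    unfolding has_vague_sum_def vague_topology_def limitin_subtopology limitin_componentwise
    using ev_dual dirac_comb_in_Cc_dual[OF D] by (auto simp: Cc_dual_def PiE_def)
qed

lemmas vague_sum_dirac = has_vague_sum_dirac_comb [THEN vague_sum_eqI]


section \<open>The polar representation and the cutting-off\<close>

text \<open>\<^term>\<open>count_space D\<close> lives on \<open>D\<close> alone; pushing it forward along the inclusion makes it a
  Borel measure on the whole space.\<close>

definition comb_measure :: "'x::topological_space set \<Rightarrow> 'x measure" where
  "comb_measure D = distr (count_space D) borel (\<lambda>x. x)"

lemma emeasure_comb_measure:
  "B \<in> sets borel \<Longrightarrow> emeasure (comb_measure D) B = emeasure (count_space D) (D \<inter> B)"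
  by (simp add: comb_measure_def emeasure_distr Int_commute)

text \<open>Outer regularity holds because every subset of a uniformly discrete set is closed, so that the
  complement of \<open>D - B\<close> is an open set containing \<open>B\<close> and not charged outside \<open>B\<close>.  Inner
  regularity holds because finite sets are compact.\<close>

lemma radon_measure_comb_measure:
  fixes D :: "'x::metric_space set"
  assumes D: "uniform_discrete D"
  shows "radon_measure (comb_measure D)"
  unfolding radon_measure_def
proof (intro conjI allI impI ballI)
  show "sets (comb_measure D) = sets borel"
    by (simp add: comb_measure_def)
next
  fix K :: "'x set" assume "compact K"
  then have "finite (D \<inter> K)" "K \<in> sets borel"
    using D by (simp_all add: finite_uniform_discrete_Int_compact borel_compact)
  then show "emeasure (comb_measure D) K < \<infinity>"
    by (simp add: emeasure_comb_measure emeasure_count_space_finite of_nat_less_top)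
next
  fix B :: "'x set" assume B: "B \<in> sets borel"
  define V where "V = - (D - B)"
  have "closed (D - B)"
    using D by (intro uniform_discrete_imp_closed uniform_discrete_subset[OF D]) auto
  then have "open V"
    unfolding V_def by (rule open_Compl)
  then have V: "open V" "B \<subseteq> V" "D \<inter> V = D \<inter> B"
    by (auto simp: V_def)
  show "emeasure (comb_measure D) B = (INF U\<in>{U. open U \<and> B \<subseteq> U}. emeasure (comb_measure D) U)"
  proof (rule antisym)
    show "emeasure (comb_measure D) B \<le> (INF U\<in>{U. open U \<and> B \<subseteq> U}. emeasure (comb_measure D) U)"
      by (intro INF_greatest emeasure_mono) (auto simp: comb_measure_def)
    have "emeasure (comb_measure D) V = emeasure (comb_measure D) B"
      using V B by (simp add: emeasure_comb_measure)
    then show "(INF U\<in>{U. open U \<and> B \<subseteq> U}. emeasure (comb_measure D) U) \<le> emeasure (comb_measure D) B"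
      using V by (metis (mono_tags, lifting) INF_lower mem_Collect_eq)
  qed
next
  fix U :: "'x set" assume U: "open U"
  let ?S = "SUP K\<in>{K. compact K \<and> K \<in> sets borel \<and> K \<subseteq> U}. emeasure (comb_measure D) K"
  have fin: "of_nat (card F) \<le> ?S" if F: "finite F" "F \<subseteq> D \<inter> U" for F
  proof -
    have "F \<in> sets borel" "compact F" "D \<inter> F = F"
      using F by (auto intro: finite_imp_compact borel_compact)
    then have "emeasure (comb_measure D) F = of_nat (card F)"
      using F by (simp add: emeasure_comb_measure emeasure_count_space_finite)
    with F \<open>F \<in> sets borel\<close> \<open>compact F\<close> show ?thesis
      by (intro SUP_upper2[of F]) auto
  qed
  show "emeasure (comb_measure D) U = ?S"
  proof (rule antisym)
    show "?S \<le> emeasure (comb_measure D) U"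
      using U by (intro SUP_least emeasure_mono) (auto simp: comb_measure_def)
    show "emeasure (comb_measure D) U \<le> ?S"
    proof (cases "finite (D \<inter> U)")
      case True
      then show ?thesis
        using fin[of "D \<inter> U"] U by (simp add: emeasure_comb_measure emeasure_count_space_finite)
    next
      case False
      have "of_nat n \<le> ?S" for n
        using infinite_arbitrarily_large[OF False, of n] fin by blast
      then have "?S = \<infinity>"
        by (metis ennreal_Ex_less_of_nat infinity_ennreal_def less_top not_less)
      then show ?thesis
        by (simp only: infinity_ennreal_def top_greatest)
    qed
  qed
qed

lemma set_integral_comb_measure:
  fixes \<phi> :: "'x::metric_space \<Rightarrow> complex"
  assumes D: "uniform_discrete D" and \<phi>: "\<phi> \<in> Cc" and C: "C \<in> sets borel"
  shows "(LINT x:C|comb_measure D. \<phi> x) = dirac_comb (D \<inter> C) \<phi>"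
proof -
  have "\<phi> \<in> borel_measurable borel"
    using \<phi> by (simp add: Cc_def borel_measurable_continuous_onI)
  then have "(LINT x:C|comb_measure D. \<phi> x) = (LINT x|count_space D. indicator C x *\<^sub>R \<phi> x)"
    using C unfolding set_lebesgue_integral_def comb_measure_def by (intro integral_distr) auto
  also have "\<dots> = (\<Sum>x | x \<in> D \<and> indicator C x *\<^sub>R \<phi> x \<noteq> 0. indicator C x *\<^sub>R \<phi> x)"
    by (rule lebesgue_integral_count_space_finite_support,
        rule finite_subset[OF _ finite_uniform_discrete_support[OF D \<phi>]]) auto
  also have "\<dots> = (\<Sum>x | x \<in> D \<inter> C \<and> \<phi> x \<noteq> 0. \<phi> x)"
    by (intro sum.cong) (auto simp: indicator_def)
  finally show ?thesis
    using \<phi> by (simp add: dirac_comb_def)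
qed

lemma polar_rep_dirac_comb:
  fixes D :: "'x::metric_space set"
  assumes "uniform_discrete D"
  shows "polar_rep (dirac_comb D) (comb_measure D) (\<lambda>_. 1)"
  using radon_measure_comb_measure[OF assms] set_integral_comb_measure[OF assms, of _ UNIV]
  by (simp add: polar_rep_def set_lebesgue_integral_def)

lemma cut_dual_dirac_comb:
  fixes D :: "'x::metric_space set"
  assumes "uniform_discrete D" "closed C"
  shows "cut_dual (dirac_comb D) C = dirac_comb (D \<inter> C)"
proof -
  have "cut_dual (dirac_comb D) C = (\<lambda>\<phi>\<in>Cc. LINT x:C|comb_measure D. \<phi> x)"
    using cut_dual_eq[OF polar_rep_dirac_comb] assms by simp
  also have "\<dots> = dirac_comb (D \<inter> C)"
  proof (rule extensionalityI[where A = Cc])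
    show "(\<lambda>\<phi>\<in>Cc. LINT x:C|comb_measure D. \<phi> x) \<phi> = dirac_comb (D \<inter> C) \<phi>" if "\<phi> \<in> Cc" for \<phi>
      using assms that by (simp add: set_integral_comb_measure)
  qed (simp_all add: dirac_comb_def)
  finally show ?thesis .
qed


section \<open>The group action\<close>

lemma isometric_action_inverse:
  assumes "isometric_action G \<alpha>" "\<gamma> \<in> carrier G"
  shows "\<alpha> \<gamma> (\<alpha> (inv\<^bsub>G\<^esub> \<gamma>) x) = x" "\<alpha> (inv\<^bsub>G\<^esub> \<gamma>) (\<alpha> \<gamma> x) = x"
proof -
  interpret group_action G UNIV \<alpha>
    using assms by (simp add: isometric_action_def)
  interpret group G
    using group_hom by (simp add: group_hom_def)
  have one: "\<alpha> \<one>\<^bsub>G\<^esub> x = x"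
    using id_eq_one by (metis UNIV_I restrict_apply')
  show "\<alpha> \<gamma> (\<alpha> (inv\<^bsub>G\<^esub> \<gamma>) x) = x" "\<alpha> (inv\<^bsub>G\<^esub> \<gamma>) (\<alpha> \<gamma> x) = x"
    using composition_rule[of x \<gamma> "inv\<^bsub>G\<^esub> \<gamma>"] composition_rule[of x "inv\<^bsub>G\<^esub> \<gamma>" \<gamma>] assms(2) one
    by simp_all
qed

lemma Cc_compose_homeomorphism:
  assumes f: "continuous_on UNIV f" and g: "continuous_on UNIV g"
    and inverse: "\<And>x. f (g x) = x" "\<And>x. g (f x) = x"
    and \<phi>: "\<phi> \<in> Cc"
  shows "(\<lambda>x. \<phi> (f x)) \<in> Cc"
proof -
  have "compact (g ` closure {x. \<phi> x \<noteq> 0})"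
    using \<phi> by (intro compact_continuous_image continuous_on_subset[OF g]) (auto simp: Cc_def)
  moreover have "g ` closure {x. \<phi> x \<noteq> 0} = f -` closure {x. \<phi> x \<noteq> 0}"
    by (auto simp: inverse intro: rev_image_eqI)
  moreover have "closed (f -` closure {x. \<phi> x \<noteq> 0})"
    using f by (intro closed_vimage) auto
  moreover have "{x. \<phi> (f x) \<noteq> 0} \<subseteq> f -` closure {x. \<phi> x \<noteq> 0}"
    using closure_subset by fastforce
  ultimately have "compact (closure {x. \<phi> (f x) \<noteq> 0})"
    by (metis closed_closure closure_minimal compact_Int_closed inf.absorb2)
  moreover have "continuous_on UNIV (\<lambda>x. \<phi> (f x))"
    using f \<phi> by (intro continuous_on_compose2[of UNIV \<phi> UNIV f]) (auto simp: Cc_def)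
  ultimately show ?thesis
    by (simp add: Cc_def)
qed

lemma uniform_discrete_isometric_image:
  assumes "isometric_action G \<alpha>" "\<gamma> \<in> carrier G" "uniform_discrete D"
  shows "uniform_discrete (\<alpha> \<gamma> ` D)"
  using assms unfolding isometric_action_def
  by (intro uniform_discrete_image_scale[OF assms(3), of 1]) auto

lemma act_dual_dirac_comb:
  fixes \<alpha> :: "'g \<Rightarrow> 'x::metric_space \<Rightarrow> 'x"
  assumes "group G" and \<alpha>: "isometric_action G \<alpha>" and \<gamma>: "\<gamma> \<in> carrier G"
  shows "act_dual G \<alpha> \<gamma> (dirac_comb D) = dirac_comb (\<alpha> \<gamma> ` D)"
proof -
  interpret group G by fact
  note inverse = isometric_action_inverse[OF \<alpha> \<gamma>]
  have iso: "dist (\<alpha> \<eta> x) (\<alpha> \<eta> y) = dist x y" if "\<eta> \<in> carrier G" for \<eta> x y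
    using \<alpha> that by (simp add: isometric_action_def)
  have cont: "continuous_on UNIV (\<alpha> \<eta>)" if "\<eta> \<in> carrier G" for \<eta>
    using iso[OF that] by (auto simp: continuous_on_iff)
  have "dirac_comb D (act_fun G \<alpha> (inv\<^bsub>G\<^esub> \<gamma>) \<phi>) = dirac_comb (\<alpha> \<gamma> ` D) \<phi>" if \<phi>: "\<phi> \<in> Cc" for \<phi>
  proof -
    have "(\<lambda>x. \<phi> (\<alpha> \<gamma> x)) \<in> Cc"
      by (rule Cc_compose_homeomorphism[OF cont[OF \<gamma>] cont[OF inv_closed[OF \<gamma>]] inverse \<phi>])
    moreover have "(\<Sum>x | x \<in> D \<and> \<phi> (\<alpha> \<gamma> x) \<noteq> 0. \<phi> (\<alpha> \<gamma> x)) = (\<Sum>y | y \<in> \<alpha> \<gamma> ` D \<and> \<phi> y \<noteq> 0. \<phi> y)"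
      by (rule sum.reindex_bij_witness[of _ "\<alpha> (inv\<^bsub>G\<^esub> \<gamma>)" "\<alpha> \<gamma>"]) (auto simp: inverse)
    ultimately show ?thesis
      using \<phi> \<gamma> by (simp add: act_fun_def dirac_comb_def)
  qed
  then show ?thesis
    by (intro extensionalityI[where A = Cc]) (simp_all add: act_dual_def dirac_comb_def)
qed


section \<open>Recovering the point set from the comb\<close>

text \<open>If \<open>x \<in> D - E\<close>, a tent function at \<open>x\<close> that vanishes on the closed set \<open>E\<close> and at the
  other points of \<open>D\<close> takes the value \<open>1\<close> under the comb of \<open>D\<close> and \<open>0\<close> under that of \<open>E\<close>.
  Properness makes the support compact.\<close>

lemma dirac_comb_eq_imp_subset:
  fixes D E :: "'x::metric_space set"
  assumes proper: "proper_space TYPE('x)"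
    and D: "uniform_discrete D" and E: "uniform_discrete E"
    and eq: "dirac_comb D = dirac_comb E"
  shows "D \<subseteq> E"
proof
  fix x assume "x \<in> D"
  show "x \<in> E"
  proof (rule ccontr)
    assume "x \<notin> E"
    have "closed (D - {x} \<union> E)"
      using E uniform_discrete_subset[OF D Diff_subset] by (simp add: closed_Un uniform_discrete_imp_closed)
    then have "open (- (D - {x} \<union> E))"
      by (rule open_Compl)
    moreover have "x \<in> - (D - {x} \<union> E)"
      using \<open>x \<notin> E\<close> by simp
    ultimately obtain e where e: "e > 0" "ball x e \<subseteq> - (D - {x} \<union> E)"
      using open_contains_ball by blast
    define \<phi> where "\<phi> y = complex_of_real (max 0 (1 - dist x y / e))" for y
    have supp: "y \<in> ball x e" if "\<phi> y \<noteq> 0" for y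
      using that e(1) by (auto simp: \<phi>_def max_def field_simps split: if_splits)
    have "closure {y. \<phi> y \<noteq> 0} \<subseteq> cball x e"
      using supp by (intro closure_minimal) (auto simp: less_imp_le)
    then have "compact (closure {y. \<phi> y \<noteq> 0})"
      using proper unfolding proper_space_def
      by (metis closed_closure compact_Int_closed inf.absorb2)
    moreover have "continuous_on UNIV \<phi>"
      unfolding \<phi>_def by (intro continuous_intros) (use e(1) in auto)
    ultimately have "\<phi> \<in> Cc"
      by (simp add: Cc_def)
    then have "dirac_comb D \<phi> = sum \<phi> {x}" "dirac_comb E \<phi> = sum \<phi> {}"
      using supp e(2) \<open>x \<in> D\<close> by (intro dirac_comb_eq_sum; blast)+
    then show False
      using eq by (simp add: \<phi>_def)
  qed
qed

lemma dirac_comb_inject: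
  fixes D E :: "'x::metric_space set"
  assumes "proper_space TYPE('x)" "uniform_discrete D" "uniform_discrete E"
  shows "dirac_comb D = dirac_comb E \<longleftrightarrow> D = E"
  using assms dirac_comb_eq_imp_subset by (metis subset_antisym)


section \<open>The comb as an abstract pattern\<close>

theorem proposition3p25:
  fixes G :: "('g, 'b) monoid_scheme"
    and \<alpha> :: "'g \<Rightarrow> 'x::metric_space \<Rightarrow> 'x"
    and D :: "'x set"
    and \<mu> :: "('x \<Rightarrow> complex) \<Rightarrow> complex"
  assumes "locally_compact_space (euclidean :: 'x topology)"
    and "proper_space TYPE('x)"
    and "group G"
    and "isometric_action G \<alpha>"
    and "uniform_discrete D"
    and "\<mu> = vague_sum dirac D"
  shows "has_vague_sum dirac D \<mu> \<and>
    D \<in> patterns (UD \<alpha>) \<and> \<mu> \<in> patterns (CcDual G \<alpha>) \<and>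
    (\<forall>C. closed C \<longrightarrow> cut (CcDual G \<alpha>) \<mu> C = vague_sum dirac (D \<inter> C)) \<and>
    (\<forall>\<gamma>\<in>carrier G. act (CcDual G \<alpha>) \<gamma> \<mu> = vague_sum dirac (\<alpha> \<gamma> ` D)) \<and>
    mutually_locally_derivable G (CcDual G \<alpha>) \<mu> (UD \<alpha>) D"
proof (intro conjI ballI allI impI)
  note D = \<open>uniform_discrete D\<close>
  have \<mu>: "\<mu> = dirac_comb D"
    using assms(6) vague_sum_dirac[OF D] by simp
  have image: "uniform_discrete (\<alpha> \<gamma> ` D)" if "\<gamma> \<in> carrier G" for \<gamma>
    using assms(4) that D by (rule uniform_discrete_isometric_image)
  have Int: "uniform_discrete (E \<inter> C)" if "uniform_discrete E" for E C :: "'x set"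
    using that by (rule uniform_discrete_subset) simp
  have act: "act (CcDual G \<alpha>) \<gamma> \<mu> = dirac_comb (\<alpha> \<gamma> ` D)" if "\<gamma> \<in> carrier G" for \<gamma>
    using act_dual_dirac_comb[OF assms(3,4) that] by (simp add: CcDual_def \<mu>)
  show "has_vague_sum dirac D \<mu>"
    unfolding \<mu> using D by (rule has_vague_sum_dirac_comb)
  show "D \<in> patterns (UD \<alpha>)"
    using D by (simp add: UD_def)
  show "\<mu> \<in> patterns (CcDual G \<alpha>)"
    using dirac_comb_in_Cc_dual[OF D] by (simp add: CcDual_def \<mu>)
  show "cut (CcDual G \<alpha>) \<mu> C = vague_sum dirac (D \<inter> C)" if "closed C" for C
    using cut_dual_dirac_comb[OF D that] vague_sum_dirac[OF Int[OF D]] by (simp add: CcDual_def \<mu>)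
  show "act (CcDual G \<alpha>) \<gamma> \<mu> = vague_sum dirac (\<alpha> \<gamma> ` D)" if "\<gamma> \<in> carrier G" for \<gamma>
    using act[OF that] vague_sum_dirac[OF image[OF that]] by simp
  have "cut (CcDual G \<alpha>) (act (CcDual G \<alpha>) \<gamma> \<mu>) C = dirac_comb (\<alpha> \<gamma> ` D \<inter> C)"
    if "\<gamma> \<in> carrier G" "closed C" for \<gamma> C
    using cut_dual_dirac_comb[OF image[OF that(1)] that(2)] act[OF that(1)] by (simp add: CcDual_def)
  then have same_patches:
    "cut (CcDual G \<alpha>) (act (CcDual G \<alpha>) \<gamma> \<mu>) C = cut (CcDual G \<alpha>) (act (CcDual G \<alpha>) \<eta> \<mu>) C \<longleftrightarrow>
     cut (UD \<alpha>) (act (UD \<alpha>) \<gamma> D) C = cut (UD \<alpha>) (act (UD \<alpha>) \<eta> D) C"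
    if "\<gamma> \<in> carrier G" "\<eta> \<in> carrier G" "closed C" for \<gamma> \<eta> C
    using that by (simp add: UD_def dirac_comb_inject[OF assms(2)] Int image)
  show "mutually_locally_derivable G (CcDual G \<alpha>) \<mu> (UD \<alpha>) D"
    unfolding mutually_locally_derivable_def locally_derivable_def
  proof (intro conjI)
    \<comment> \<open>Any base point serves, as long as it is the same on both sides.\<close>
    fix x :: 'x
    show "\<exists>x0 y0. \<exists>R0\<ge>0. \<forall>\<gamma>\<in>carrier G. \<forall>\<eta>\<in>carrier G. \<forall>R\<ge>0.
        cut (CcDual G \<alpha>) (act (CcDual G \<alpha>) \<gamma> \<mu>) (cball x0 (R + R0)) =
        cut (CcDual G \<alpha>) (act (CcDual G \<alpha>) \<eta> \<mu>) (cball x0 (R + R0)) \<longrightarrow>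
        cut (UD \<alpha>) (act (UD \<alpha>) \<gamma> D) (cball y0 R) = cut (UD \<alpha>) (act (UD \<alpha>) \<eta> D) (cball y0 R)"
      by (rule exI[of _ x], rule exI[of _ x], rule exI[of _ 0]) (simp add: same_patches)
    show "\<exists>x0 y0. \<exists>R0\<ge>0. \<forall>\<gamma>\<in>carrier G. \<forall>\<eta>\<in>carrier G. \<forall>R\<ge>0.
        cut (UD \<alpha>) (act (UD \<alpha>) \<gamma> D) (cball x0 (R + R0)) =
        cut (UD \<alpha>) (act (UD \<alpha>) \<eta> D) (cball x0 (R + R0)) \<longrightarrow>
        cut (CcDual G \<alpha>) (act (CcDual G \<alpha>) \<gamma> \<mu>) (cball y0 R) =
        cut (CcDual G \<alpha>) (act (CcDual G \<alpha>) \<eta> \<mu>) (cball y0 R)"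
      by (rule exI[of _ x], rule exI[of _ x], rule exI[of _ 0]) (simp add: same_patches)
  qed
qed

end
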